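(* Let $X$ be a nonempty finite set and let $(\mathcal{P},\leq,\Omega)$ be a poset with a flow. For any order-preserving maps $\mathbf{F},\mathbf{G}:\mathcal{P}\to\mathbf{SubPart}(X)$, $$d_{\mathrm{I}}(\mathbf{F},\mathbf{G})=\max_{x,x'\in X}d_{\widehat{\Omega}}\left(\mathbf{F}^{-1}\left(\{x,x'\}^\uparrow\right),\mathbf{G}^{-1}\left(\{x,x'\}^\uparrow\right)\right),$$ where for $x=x'$ the set $\{x,x'\}$ is the singleton $\{x\}$.
   Context: A subpartition of $X$ is a partition (into nonempty disjoint blocks) of some subset $X'\subset X$ (possibly empty). $\mathbf{SubPart}(X)$ is the set of subpartitions of $X$ ordered by refinement: $P_1\leq P_2$ iff every block of $P_1$ is contained in some block of $P_2$. In the notation $\{x,x'\}^\uparrow$, $\{x,x'\}$ stands for the subpartition whose only block is $\{x,x'\}$, and $\{x,x'\}^\uparrow$ is the set of all subpartitions $P$ above it, i.e. those in which $x$ and $x'$ lie in a common block. A (strict) flow on a poset $\mathcal{P}$ is a family $\Omega=\{\Omega_\varepsilon:\mathcal{P}\to\mathcal{P}\}_{\varepsilon\in[0,\infty)}$ of order-preserving maps such that $\Omega_s\leq\Omega_t$ pointwise for $s\leq t$, $\Omega_t\Omega_s=\Omega_{t+s}$, and $\Omega_0=\mathrm{id}_{\mathcal{P}}$. $d_{\mathrm{I}}(\mathbf{F},\mathbf{G})$ is the infimum of all $\varepsilon\in[0,\infty)$ such that $\mathbf{F}(p)\leq\mathbf{G}(\Omega_\varepsilon(p))$ and $\mathbf{G}(p)\leq\mathbf{F}(\Omega_\varepsilon(p))$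 for all $p\in\mathcal{P}$ ($\infty$ if there is none). For an upper set $A\subset\mathcal{P}$ (i.e. $p\in A$, $p\leq q$ imply $q\in A$), $\widehat{\Omega}_\varepsilon(A):=\{p\in\mathcal{P}:\Omega_\varepsilon(p)\in A\}$, and for upper sets $A,A'$, $d_{\widehat{\Omega}}(A,A'):=\inf\{\varepsilon\in[0,\infty):A\subset\widehat{\Omega}_\varepsilon(A')\text{ and }A'\subset\widehat{\Omega}_\varepsilon(A)\}$ ($\infty$ if there is no such $\varepsilon$). *)

theory Defs
  imports
    "HOL-Library.Disjoint_Sets"
    "HOL-Library.Extended_Real"
    "HOL-Library.FuncSet"
begin

text \<open>
  Posets are given by an explicit carrier and an order predicate, of which only the restriction
  to the carrier matters. In particular the empty poset is allowed.
\<close>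

definition poset_on :: "'p set \<Rightarrow> ('p \<Rightarrow> 'p \<Rightarrow> bool) \<Rightarrow> bool" where
  "poset_on P le \<longleftrightarrow> reflp_on P le \<and> transp_on P le \<and> antisymp_on P le"

definition flow_on :: "'p set \<Rightarrow> ('p \<Rightarrow> 'p \<Rightarrow> bool) \<Rightarrow> (real \<Rightarrow> 'p \<Rightarrow> 'p) \<Rightarrow> bool" where
  "flow_on P le \<Omega> \<longleftrightarrow>
     (\<forall>t\<ge>0. \<Omega> t \<in> P \<rightarrow> P \<and> monotone_on P le le (\<Omega> t)) \<and>
     (\<forall>s\<ge>0. \<forall>t\<ge>s. \<forall>p\<in>P. le (\<Omega> s p) (\<Omega> t p)) \<and>
     (\<forall>s\<ge>0. \<forall>t\<ge>0. \<forall>p\<in>P. \<Omega> t (\<Omega> s p) = \<Omega> (t + s) p) \<and>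
     (\<forall>p\<in>P. \<Omega> 0 p = p)"

definition SubPart :: "'a set \<Rightarrow> 'a set set set" where
  "SubPart X = {S. \<exists>X'\<subseteq>X. partition_on X' S}"

text \<open>
  The library's \<open>refines\<close> compares partitions of one fixed set only; here the underlying subset
  may grow.
\<close>

definition subpart_le :: "'a set set \<Rightarrow> 'a set set \<Rightarrow> bool" where
  "subpart_le S T \<longleftrightarrow> (\<forall>B\<in>S. \<exists>C\<in>T. B \<subseteq> C)"

definition subpart_up :: "'a set \<Rightarrow> 'a set set \<Rightarrow> 'a set set set" where
  "subpart_up X S = {T \<in> SubPart X. subpart_le S T}"

text \<open>Both distances are extended reals; \<open>Inf {} = \<infinity>\<close> in \<^typ>\<open>ereal\<close>.\<close>

definition interleaving_dist ::
  "'p set \<Rightarrow> (real \<Rightarrow> 'p \<Rightarrow> 'p) \<Rightarrow> ('q \<Rightarrow> 'q \<Rightarrow> bool) \<Rightarrow> ('p \<Rightarrow> 'q) \<Rightarrow> ('p \<Rightarrow> 'q) \<Rightarrow> ereal" where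
  "interleaving_dist P \<Omega> leQ F G =
     Inf (ereal ` {e. 0 \<le> e \<and> (\<forall>p\<in>P. leQ (F p) (G (\<Omega> e p)) \<and> leQ (G p) (F (\<Omega> e p)))})"

definition upper_set_on :: "'p set \<Rightarrow> ('p \<Rightarrow> 'p \<Rightarrow> bool) \<Rightarrow> 'p set \<Rightarrow> bool" where
  "upper_set_on P le A \<longleftrightarrow> A \<subseteq> P \<and> (\<forall>p\<in>A. \<forall>q\<in>P. le p q \<longrightarrow> q \<in> A)"

definition flow_hat :: "'p set \<Rightarrow> (real \<Rightarrow> 'p \<Rightarrow> 'p) \<Rightarrow> real \<Rightarrow> 'p set \<Rightarrow> 'p set" where
  "flow_hat P \<Omega> e A = {p \<in> P. \<Omega> e p \<in> A}"

text \<open>Meant for upper sets \<open>A\<close> and \<open>B\<close> of the poset \<open>P\<close>.\<close>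

definition flow_hat_dist ::
  "'p set \<Rightarrow> (real \<Rightarrow> 'p \<Rightarrow> 'p) \<Rightarrow> 'p set \<Rightarrow> 'p set \<Rightarrow> ereal" where
  "flow_hat_dist P \<Omega> A B =
     Inf (ereal ` {e. 0 \<le> e \<and> A \<subseteq> flow_hat P \<Omega> e B \<and> B \<subseteq> flow_hat P \<Omega> e A})"

definition preimage_on :: "'p set \<Rightarrow> ('p \<Rightarrow> 'q) \<Rightarrow> 'q set \<Rightarrow> 'p set" where
  "preimage_on P F A = {p \<in> P. F p \<in> A}"

text \<open>The preimages to which \<^const>\<open>flow_hat_dist\<close> is applied are indeed upper sets.\<close>

lemma upper_set_on_preimage_subpart_up:
  assumes "F \<in> P \<rightarrow> SubPart X" and "monotone_on P le subpart_le F"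
  shows "upper_set_on P le (preimage_on P F (subpart_up X S))"
proof -
  have trans: "subpart_le S U" if "subpart_le S T" "subpart_le T U" for T U
    using that unfolding subpart_le_def by (meson subset_trans)
  show ?thesis
    using assms(1) monotone_onD[OF assms(2)] trans
    unfolding upper_set_on_def preimage_on_def subpart_up_def by blast
qed

end

theory Submission
  imports Defs
begin

text \<open>
  A subpartition is determined, together with its position in the refinement order, by the pairs of
  points that it puts into a common block: \<open>S\<close> refines \<open>T\<close> exactly if every such pair of \<open>S\<close> is one
  of \<open>T\<close> (\<open>subpart_le_iff_pairs\<close>). Hence the condition that \<open>\<epsilon>\<close> interleaves \<open>F\<close> and \<open>G\<close> splits into
  one condition for each pair \<open>(x, x')\<close>, and the latter is the condition on \<open>\<epsilon>\<close> in the definition of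
  the distance between the two preimages. The admissible \<open>\<epsilon>\<close> for \<open>F\<close> and \<open>G\<close> thus form the
  intersection, over the pairs, of the sets of \<open>\<epsilon>\<close> admissible for one pair.

  In general the infimum of an intersection is only bounded below by the supremum of the infima. Here
  equality holds because, by monotonicity of the flow in time, each of these sets is closed under
  increasing \<open>\<epsilon>\<close>, so that it contains every real number above its infimum
  (\<open>Inf_INT_upward_closed\<close>). Finiteness of \<open>X\<close> makes the supremum a maximum.
\<close>

text \<open>
  Any number above the maximum of the infima lies in all the sets: each set has a smaller element
  and is upward closed.
\<close>

lemma Inf_INT_upward_closed:
  fixes E :: "'i \<Rightarrow> real set"
  assumes "finite I" and "I \<noteq> {}"
    and up: "\<And>i d e. i \<in> I \<Longrightarrow> d \<in> E i \<Longrightarrow> d \<le> e \<Longrightarrow> e \<in> E i"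
  shows "Inf (ereal ` (\<Inter>i\<in>I. E i)) = (MAX i\<in>I. Inf (ereal ` E i))" (is "?l = ?r")
proof (rule antisym)
  show "?r \<le> ?l"
    using assms(1,2) by (auto intro!: Inf_superset_mono)
  show "?l \<le> ?r"
  proof (rule dense_ge)
    fix r assume r: "?r < r"
    show "?l \<le> r"
    proof (cases r)
      case (real e)
      have "e \<in> E i" if "i \<in> I" for i
      proof -
        have "Inf (ereal ` E i) < ereal e"
          using r real that assms(1,2) by simp
        then obtain d where "d \<in> E i" and "d < e"
          by (auto simp: Inf_less_iff)
        then show ?thesis
          using up[OF that] by force
      qed
      then show ?thesis
        unfolding real by (auto intro: Inf_lower)
    qed (use r in auto)
  qed
qed

lemma mem_subpart_up_pair_iff:
  "S \<in> subpart_up X {{x, x'}} \<longleftrightarrow> S \<in> SubPart X \<and> (\<exists>B\<in>S. x \<in> B \<and> x' \<in> B)"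
  unfolding subpart_up_def subpart_le_def by auto

text \<open>
  For the converse direction, fix a point \<open>x\<close> of a block \<open>B\<close> of \<open>S\<close>. Each \<open>y \<in> B\<close> shares a block of
  \<open>T\<close> with \<open>x\<close>; as the blocks of \<open>T\<close> are disjoint, this is the same block for all \<open>y\<close>, and it
  contains \<open>B\<close>. The diagonal pair \<open>(x, x)\<close> expresses that \<open>x\<close> belongs to the underlying set.
\<close>

lemma subpart_le_iff_pairs:
  assumes S: "S \<in> SubPart X" and T: "T \<in> SubPart X"
  shows "subpart_le S T \<longleftrightarrow>
    (\<forall>x\<in>X. \<forall>x'\<in>X. S \<in> subpart_up X {{x, x'}} \<longrightarrow> T \<in> subpart_up X {{x, x'}})"
proof
  assume "subpart_le S T"
  then show "\<forall>x\<in>X. \<forall>x'\<in>X. S \<in> subpart_up X {{x, x'}} \<longrightarrow> T \<in> subpart_up X {{x, x'}}"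
    using T unfolding mem_subpart_up_pair_iff subpart_le_def by (meson subsetD)
next
  assume pairs: "\<forall>x\<in>X. \<forall>x'\<in>X. S \<in> subpart_up X {{x, x'}} \<longrightarrow> T \<in> subpart_up X {{x, x'}}"
  have common: "\<exists>C\<in>T. x \<in> C \<and> y \<in> C" if "B \<in> S" "x \<in> B" "y \<in> B" for B x y
  proof -
    have "x \<in> X" "y \<in> X"
      using S that unfolding SubPart_def partition_on_def by auto
    moreover have "S \<in> subpart_up X {{x, y}}"
      using S that unfolding mem_subpart_up_pair_iff by auto
    ultimately have "T \<in> subpart_up X {{x, y}}"
      using pairs by simp
    then show ?thesis
      unfolding mem_subpart_up_pair_iff by simp
  qed
  show "subpart_le S T"
    unfolding subpart_le_def
  proof
    fix B assume B: "B \<in> S"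
    then obtain x where x: "x \<in> B"
      using S unfolding SubPart_def partition_on_def by fastforce
    obtain C where C: "C \<in> T" "x \<in> C"
      using common[OF B x x] by blast
    have "y \<in> C" if y: "y \<in> B" for y
    proof -
      obtain D where D: "D \<in> T" "x \<in> D" "y \<in> D"
        using common[OF B x y] by blast
      have "disjoint T"
        using T unfolding SubPart_def partition_on_def by blast
      then have "D = C"
        using C D by (auto dest: disjointD)
      then show ?thesis
        using D by simp
    qed
    then show "\<exists>C\<in>T. B \<subseteq> C"
      using C by blast
  qed
qed

text \<open>
  Flowing longer moves a point further up, and an upper set keeps it. This makes the set of admissible
  \<open>\<epsilon>\<close> of a single pair upward closed.
\<close>

lemma flow_hat_mono_time:
  assumes "flow_on P le \<Omega>" and A: "upper_set_on P le A" and "0 \<le> d" and "d \<le> e"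
  shows "flow_hat P \<Omega> d A \<subseteq> flow_hat P \<Omega> e A"
proof
  fix p assume "p \<in> flow_hat P \<Omega> d A"
  then have p: "p \<in> P" "\<Omega> d p \<in> A"
    unfolding flow_hat_def by auto
  have "\<Omega> e \<in> P \<rightarrow> P" and "le (\<Omega> d p) (\<Omega> e p)"
    using assms(1,3,4) p(1) order_trans[OF assms(3,4)] unfolding flow_on_def by blast+
  then have "le (\<Omega> d p) (\<Omega> e p)" and "\<Omega> e p \<in> P"
    using p(1) by (simp_all add: Pi_iff)
  then show "p \<in> flow_hat P \<Omega> e A"
    using A p unfolding flow_hat_def upper_set_on_def by blast
qed

lemma interleaving_iff_pairs:
  assumes F: "F \<in> P \<rightarrow> SubPart X" and G: "G \<in> P \<rightarrow> SubPart X" and w: "w \<in> P \<rightarrow> P"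
  shows "(\<forall>p\<in>P. subpart_le (F p) (G (w p))) \<longleftrightarrow>
    (\<forall>x\<in>X. \<forall>x'\<in>X. preimage_on P F (subpart_up X {{x, x'}})
       \<subseteq> {p \<in> P. w p \<in> preimage_on P G (subpart_up X {{x, x'}})})"
proof -
  have "subpart_le (F p) (G (w p)) \<longleftrightarrow> (\<forall>x\<in>X. \<forall>x'\<in>X.
      F p \<in> subpart_up X {{x, x'}} \<longrightarrow> G (w p) \<in> subpart_up X {{x, x'}})" if "p \<in> P" for p
    using that F G w by (intro subpart_le_iff_pairs) auto
  then show ?thesis
    using w unfolding preimage_on_def by blast
qed

theorem theorem4p17:
  fixes X :: "'a set"
    and P :: "'p set"
    and le :: "'p \<Rightarrow> 'p \<Rightarrow> bool"
    and \<Omega> :: "real \<Rightarrow> 'p \<Rightarrow> 'p"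
    and F G :: "'p \<Rightarrow> 'a set set"
  assumes "finite X" and "X \<noteq> {}"
    and "poset_on P le" and "flow_on P le \<Omega>"
    and "F \<in> P \<rightarrow> SubPart X" and "monotone_on P le subpart_le F"
    and "G \<in> P \<rightarrow> SubPart X" and "monotone_on P le subpart_le G"
  shows "interleaving_dist P \<Omega> subpart_le F G =
    (MAX (x, x') \<in> X \<times> X.
      flow_hat_dist P \<Omega>
        (preimage_on P F (subpart_up X {{x, x'}}))
        (preimage_on P G (subpart_up X {{x, x'}})))"
proof -
  define A where "A H z = preimage_on P H (subpart_up X {{fst z, snd z}})"
    for H :: "'p \<Rightarrow> 'a set set" and z
  define E where "E z = {e. 0 \<le> e \<and> A F z \<subseteq> flow_hat P \<Omega> e (A G z)
    \<and> A G z \<subseteq> flow_hat P \<Omega> e (A F z)}" for z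
  have upper: "upper_set_on P le (A F z)" "upper_set_on P le (A G z)" for z
    unfolding A_def using assms(5-8) by (simp_all add: upper_set_on_preimage_subpart_up)
  have up: "e \<in> E z" if "d \<in> E z" "d \<le> e" for z d e
  proof -
    have "0 \<le> d" and d: "A F z \<subseteq> flow_hat P \<Omega> d (A G z)" "A G z \<subseteq> flow_hat P \<Omega> d (A F z)"
      using that(1) unfolding E_def by auto
    then show ?thesis
      using flow_hat_mono_time[OF assms(4) upper(1) _ that(2), of z]
        flow_hat_mono_time[OF assms(4) upper(2) _ that(2), of z] that(2)
      unfolding E_def by (simp add: subset_trans[OF d(1)] subset_trans[OF d(2)])
  qed
  have "(\<forall>p\<in>P. subpart_le (F p) (G (\<Omega> e p)) \<and> subpart_le (G p) (F (\<Omega> e p))) \<longleftrightarrow>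
      (\<forall>z\<in>X \<times> X. A F z \<subseteq> flow_hat P \<Omega> e (A G z) \<and> A G z \<subseteq> flow_hat P \<Omega> e (A F z))"
    if "0 \<le> e" for e
  proof -
    have w: "\<Omega> e \<in> P \<rightarrow> P"
      using assms(4) that unfolding flow_on_def by blast
    show ?thesis
      unfolding ball_conj_distrib interleaving_iff_pairs[OF assms(5,7) w]
        interleaving_iff_pairs[OF assms(7,5) w]
      unfolding A_def flow_hat_def by simp
  qed
  \<comment> \<open>Nonnegativity of the elements of the intersection uses that there is at least one pair.\<close>
  then have "{e. 0 \<le> e \<and> (\<forall>p\<in>P. subpart_le (F p) (G (\<Omega> e p)) \<and> subpart_le (G p) (F (\<Omega> e p)))}
      = (\<Inter>z\<in>X \<times> X. E z)"
    using \<open>X \<noteq> {}\<close> unfolding E_def by blast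
  then have "interleaving_dist P \<Omega> subpart_le F G = Inf (ereal ` (\<Inter>z\<in>X \<times> X. E z))"
    unfolding interleaving_dist_def by simp
  also have "\<dots> = (MAX z\<in>X \<times> X. Inf (ereal ` E z))"
    using assms(1,2) up by (intro Inf_INT_upward_closed) auto
  also have "\<dots> = (MAX (x, x') \<in> X \<times> X. flow_hat_dist P \<Omega>
      (preimage_on P F (subpart_up X {{x, x'}})) (preimage_on P G (subpart_up X {{x, x'}})))"
    unfolding E_def A_def flow_hat_dist_def by (simp add: case_prod_beta)
  finally show ?thesis .
qed

end
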